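(* Let $G$ be a connected non-bipartite graph and let $n\geq 6$ be an even integer. If $\kappa(G\times K_{2})>\frac{4}{n}\delta(G)$, then $G\times C_{n}$ is super-$\kappa$.
   Context: All graphs are simple. $C_n$ is the cycle on $n$ vertices and $K_2$ the complete graph on 2 vertices. The direct product $G\times H$ has vertex set $V(G)\times V(H)$, with $(u_1,v_1)(u_2,v_2)$ an edge iff $u_1u_2\in E(G)$ and $v_1v_2\in E(H)$. $\delta(G)$ is the minimum degree. For a non-complete graph $G$, the connectivity $\kappa(G)$ is the minimum size of a vertex set $S$ such that $G-S$ is disconnected; for a complete graph $\kappa(G)=|V(G)|-1$. A graph is super connected (super-$\kappa$) if every minimum vertex cut is the neighborhood of some vertex of minimum degree. *)

theory Defs
  imports "Graph_Theory.Graph_Theory"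
begin

text \<open>
  A finite simple graph is a \<^locale>\<open>pair_graph\<close>: a finite vertex set together with a symmetric,
  irreflexive set of arcs, each undirected edge being the two opposite arcs.  Hence the degree of a
  vertex is its out-degree.
\<close>

definition bipartite :: "'a pair_pre_digraph \<Rightarrow> bool" where
  "bipartite G \<longleftrightarrow> (\<exists>U W. pverts G = U \<union> W \<and> U \<inter> W = {} \<and> parcs G \<subseteq> U \<times> W \<union> W \<times> U)"

definition complete_graph :: "nat \<Rightarrow> nat pair_pre_digraph" where
  "complete_graph n = \<lparr> pverts = {..<n}, parcs = {(i, j). i < n \<and> j < n \<and> i \<noteq> j} \<rparr>"

text \<open>For \<open>n \<ge> 3\<close> this is the cycle on \<open>n\<close> vertices; for smaller \<open>n\<close> it is degenerate.\<close>

definition cycle_graph :: "nat \<Rightarrow> nat pair_pre_digraph" where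
  "cycle_graph n = \<lparr> pverts = {..<n},
     parcs = {(i, j). i < n \<and> j < n \<and> (j = Suc i mod n \<or> i = Suc j mod n)} \<rparr>"

definition direct_product ::
    "'a pair_pre_digraph \<Rightarrow> 'b pair_pre_digraph \<Rightarrow> ('a \<times> 'b) pair_pre_digraph"
    (infixl \<open>\<times>\<^sub>d\<close> 70) where
  "G \<times>\<^sub>d H = \<lparr> pverts = pverts G \<times> pverts H,
     parcs = {((u1, v1), (u2, v2)) | u1 v1 u2 v2. (u1, u2) \<in> parcs G \<and> (v1, v2) \<in> parcs H} \<rparr>"

definition neighborhood :: "'a pair_pre_digraph \<Rightarrow> 'a \<Rightarrow> 'a set" where
  "neighborhood G v = {u. (v, u) \<in> parcs G}"

definition min_degree :: "'a pair_pre_digraph \<Rightarrow> nat" where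
  "min_degree G = Min (out_degree (with_proj G) ` pverts G)"

text \<open>
  The library's \<^const>\<open>Digraph_Component.connected\<close> is false for the null graph, so deleting all
  vertices is excluded explicitly.
\<close>

definition vertex_cut :: "'a pair_pre_digraph \<Rightarrow> 'a set \<Rightarrow> bool" where
  "vertex_cut G S \<longleftrightarrow>
     S \<subset> pverts G \<and> \<not> Digraph_Component.connected (with_proj G \<restriction> (pverts G - S))"

definition connectivity :: "'a pair_pre_digraph \<Rightarrow> nat" where
  "connectivity G =
     (if complete_digraph (card (pverts G)) (with_proj G) then card (pverts G) - 1
      else Min (card ` {S. vertex_cut G S}))"

definition minimum_vertex_cut :: "'a pair_pre_digraph \<Rightarrow> 'a set \<Rightarrow> bool" where
  "minimum_vertex_cut G S \<longleftrightarrow> vertex_cut G S \<and> card S = connectivity G"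

definition super_connected :: "'a pair_pre_digraph \<Rightarrow> bool" where
  "super_connected G \<longleftrightarrow>
     (\<forall>S. minimum_vertex_cut G S \<longrightarrow>
        (\<exists>v \<in> pverts G. out_degree (with_proj G) v = min_degree G \<and> S = neighborhood G v))"

end

theory Submission
  imports Defs
begin

text \<open>
  Let \<open>\<delta>\<close> be the minimum degree of \<open>G\<close> and \<open>S\<close> a minimum vertex cut of \<open>G \<times> C\<^sub>n\<close>, so \<open>\<bar>S\<bar> \<le> 2\<delta>\<close>.
  Two consecutive layers induce a copy of \<open>G \<times> K\<^sub>2\<close>, and averaging over the \<open>n\<close> pairs of
  consecutive layers gives one with at most \<open>4\<delta>/n < \<kappa>(G \<times> K\<^sub>2)\<close> deleted vertices, whose rest is
  therefore connected.  A layer with fewer than \<open>\<delta>\<close> deleted vertices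
  leaves every vertex of the two adjacent layers a surviving neighbor, so connectedness spreads from
  that pair until it meets a layer with at least \<open>\<delta>\<close> deletions.  It can only fail to go all the way
  around if \<open>S\<close> consists of \<open>\<delta>\<close> vertices in each of two layers.  Then at least two layers in a row
  between these are again connected as \<open>\<kappa>(G \<times> K\<^sub>2) > 0\<close>, while a single layer between them is attached unless one
  of its vertices is isolated.  Hence \<open>S\<close> contains the neighborhood of a vertex, and it equals it
  by counting.
\<close>

section \<open>Walks inside a vertex set\<close>

lemma rtrancl_on_map:
  assumes "(x, y) \<in> rtrancl_on A r"
    and "\<And>x. x \<in> A \<Longrightarrow> h x \<in> B"
    and "\<And>x y. (x, y) \<in> r \<Longrightarrow> (h x, h y) \<in> s"
  shows "(h x, h y) \<in> rtrancl_on B s"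
  using assms(1)
proof (induction rule: rtrancl_on_induct)
  case base
  then show ?case using assms(2) by (blast dest: in_rtrancl_on_in_F)
next
  case (step y z)
  then show ?case using assms(2,3) by (blast intro: rtrancl_on_into_rtrancl_on)
qed

context pair_graph
begin

text \<open>The arcs are symmetric already, so taking the symmetric closure adds nothing, and a walk
  confined to \<open>W\<close> only uses arcs inside \<open>W\<close>.\<close>

lemma connected_induce_iff:
  "Digraph_Component.connected (with_proj G \<restriction> W) \<longleftrightarrow>
     W \<noteq> {} \<and> (\<forall>u\<in>W. \<forall>v\<in>W. (u, v) \<in> rtrancl_on W (parcs G))"
proof -
  have arcs: "parcs (mk_symmetric (with_proj G \<restriction> W)) = parcs G \<inter> W \<times> W"
    by (auto simp: parcs_mk_symmetric induce_subgraph_def intro: arcs_symmetric)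
  have "(u, v) \<in> rtrancl_on W (parcs G \<inter> W \<times> W)" if "(u, v) \<in> rtrancl_on W (parcs G)" for u v
    using that
  proof (induction rule: rtrancl_on_induct)
    case base
    then show ?case by (auto dest: in_rtrancl_on_in_F)
  next
    case (step y z)
    then show ?case by (auto intro: rtrancl_on_into_rtrancl_on)
  qed
  moreover have "(u, v) \<in> rtrancl_on W (parcs G)" if "(u, v) \<in> rtrancl_on W (parcs G \<inter> W \<times> W)" for u v
    using rtrancl_on_map[OF that, of id W "parcs G"] by auto
  ultimately have "rtrancl_on W (parcs G \<inter> W \<times> W) = rtrancl_on W (parcs G)"
    by auto
  then show ?thesis
    unfolding connected_def strongly_connected_def reachable_def with_proj_simps arcs
    by simp
qed

lemma rtrancl_on_arcs_sym: "(u, v) \<in> rtrancl_on W (parcs G) \<Longrightarrow> (v, u) \<in> rtrancl_on W (parcs G)"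
  by (metis arcs_symmetric rtrancl_on_sym symD symI)

lemma neighborhood_subset: "neighborhood G v \<subseteq> pverts G - {v}"
  by (auto simp: neighborhood_def dest: in_arcsD2 no_loops')

lemma finite_neighborhood: "finite (neighborhood G v)"
  using neighborhood_subset pair_finite_verts by (meson finite_Diff finite_subset)

end

section \<open>Minimum degree, vertex cuts and connectivity\<close>

lemma out_degree_eq_card_neighborhood: "out_degree (with_proj G) v = card (neighborhood G v)"
proof -
  have "out_arcs (with_proj G) v = Pair v ` neighborhood G v"
    by (auto simp: neighborhood_def out_arcs_def)
  then show ?thesis
    by (simp add: out_degree_def card_image inj_on_def)
qed

context pair_graph
begin

lemma min_degree_le: "v \<in> pverts G \<Longrightarrow> min_degree G \<le> card (neighborhood G v)"
  unfolding min_degree_def out_degree_eq_card_neighborhood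
  by (simp add: pair_finite_verts)

lemma min_degree_attained:
  assumes "pverts G \<noteq> {}"
  obtains v where "v \<in> pverts G" "card (neighborhood G v) = min_degree G"
proof -
  have "min_degree G \<in> out_degree (with_proj G) ` pverts G"
    unfolding min_degree_def using assms pair_finite_verts by (intro Min_in) auto
  then show ?thesis using that by (auto simp: out_degree_eq_card_neighborhood)
qed

lemma min_degree_less_order:
  assumes "pverts G \<noteq> {}"
  shows "min_degree G < card (pverts G)"
proof -
  obtain v where v: "v \<in> pverts G" "card (neighborhood G v) = min_degree G"
    using assms by (rule min_degree_attained)
  have "neighborhood G v \<subset> pverts G"
    using neighborhood_subset[of v] v by auto
  then show ?thesis using v psubset_card_mono pair_finite_verts by metis
qed

text \<open>Once its neighbors are deleted, \<open>v\<close> is isolated and cannot reach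
  \<open>w\<close>.\<close>

lemma vertex_cut_neighborhood:
  assumes "v \<in> pverts G" "w \<in> pverts G" "w \<noteq> v" "w \<notin> neighborhood G v"
  shows "vertex_cut G (neighborhood G v)"
proof -
  let ?W = "pverts G - neighborhood G v"
  have "u = v" if "(v, u) \<in> rtrancl_on ?W (parcs G)" for u
    using that by (induction rule: rtrancl_on_induct) (auto simp: neighborhood_def)
  moreover have "v \<in> ?W" using assms(1) neighborhood_subset by blast
  ultimately show ?thesis
    using assms by (auto simp: vertex_cut_def connected_induce_iff dest: neighborhood_subset[THEN subsetD])
qed

lemma finite_vertex_cuts: "finite {S. vertex_cut G S}"
  by (rule finite_subset[of _ "Pow (pverts G)"]) (auto simp: vertex_cut_def pair_finite_verts)

text \<open>In a non-complete graph, a vertex \<open>v\<close> of minimum degree has a non-neighbor,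
  so its neighborhood is a cut. Otherwise every degree would be at least
  \<open>card (pverts G) - 1\<close>, which fails at an end \<open>x\<close> of a non-adjacent
  pair.\<close>

lemma connectivity_le_min_degree:
  assumes "pverts G \<noteq> {}"
  shows "connectivity G \<le> min_degree G"
proof -
  obtain v where v: "v \<in> pverts G" "card (neighborhood G v) = min_degree G"
    using assms by (rule min_degree_attained)
  show ?thesis
  proof (cases "complete_digraph (card (pverts G)) (with_proj G)")
    case True
    then have "neighborhood G v = pverts G - {v}"
      using v by (auto simp: complete_digraph_def neighborhood_def)
    then show ?thesis using True v by (simp add: connectivity_def pair_finite_verts)
  next
    case False
    obtain x y where xy: "x \<in> pverts G" "y \<in> pverts G" "x \<noteq> y" "(x, y) \<notin> parcs G"
      using False graph_axioms in_arcsD1 in_arcsD2 no_loops'[of x x for x]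
      by (auto simp: complete_digraph_def)
    have "\<exists>w \<in> pverts G. w \<noteq> v \<and> w \<notin> neighborhood G v"
    proof (rule ccontr)
      assume "\<not> ?thesis"
      then have "pverts G - {v} \<subseteq> neighborhood G v" by blast
      then have "card (pverts G - {v}) \<le> min_degree G"
        using v card_mono finite_neighborhood by metis
      also have "\<dots> \<le> card (neighborhood G x)" using xy min_degree_le by blast
      also have "\<dots> < card (pverts G - {x})"
        using xy neighborhood_subset[of x]
        by (intro psubset_card_mono) (auto simp: pair_finite_verts neighborhood_def)
      finally show False using v xy pair_finite_verts by simp
    qed
    then have "vertex_cut G (neighborhood G v)"
      using v vertex_cut_neighborhood by blast
    then have "Min (card ` {S. vertex_cut G S}) \<le> card (neighborhood G v)"
      using finite_vertex_cuts by (intro Min_le) auto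
    then show ?thesis using False v by (simp add: connectivity_def)
  qed
qed

lemma connected_if_card_less_connectivity:
  assumes "pverts G \<noteq> {}" "T \<subseteq> pverts G" "card T < connectivity G"
  shows "Digraph_Component.connected (with_proj G \<restriction> (pverts G - T))"
proof -
  \<comment> \<open>Properness matters because the null graph counts as disconnected without arising
    from a vertex cut.\<close>
  have T: "T \<subset> pverts G"
    using assms connectivity_le_min_degree min_degree_less_order by fastforce
  show ?thesis
  proof (cases "complete_digraph (card (pverts G)) (with_proj G)")
    case True
    have "(u, v) \<in> rtrancl_on (pverts G - T) (parcs G)"
      if "u \<in> pverts G - T" "v \<in> pverts G - T" for u v
    proof (cases "u = v")
      case False
      then have "(u, v) \<in> parcs G" using True that by (auto simp: complete_digraph_def)
      with that show ?thesis by (meson rtrancl_on.intros)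
    qed (use that in auto)
    then show ?thesis using T by (auto simp: connected_induce_iff)
  next
    case False
    have "\<not> vertex_cut G T"
    proof
      assume "vertex_cut G T"
      then have "Min (card ` {S. vertex_cut G S}) \<le> card T"
        using finite_vertex_cuts by (intro Min_le) auto
      then show False using False assms by (simp add: connectivity_def)
    qed
    then show ?thesis using T by (simp add: vertex_cut_def)
  qed
qed

end

section \<open>Direct products and their factors\<close>

lemma pverts_direct_product [simp]: "pverts (G \<times>\<^sub>d H) = pverts G \<times> pverts H"
  by (simp add: direct_product_def)

lemma parcs_direct_product_iff [simp]:
  "((u, i), (v, j)) \<in> parcs (G \<times>\<^sub>d H) \<longleftrightarrow> (u, v) \<in> parcs G \<and> (i, j) \<in> parcs H"
  by (auto simp: direct_product_def)

lemma neighborhood_direct_product: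
  "neighborhood (G \<times>\<^sub>d H) (u, i) = neighborhood G u \<times> neighborhood H i"
  by (auto simp: neighborhood_def)

lemma pair_graphI:
  assumes "finite (pverts G)"
    and "\<And>u v. (u, v) \<in> parcs G \<Longrightarrow> u \<in> pverts G \<and> v \<in> pverts G \<and> u \<noteq> v \<and> (v, u) \<in> parcs G"
  shows "pair_graph G"
proof -
  have "parcs G \<subseteq> pverts G \<times> pverts G" using assms(2) by auto
  then have "finite (parcs G)" using assms(1) by (meson finite_SigmaI finite_subset)
  then show ?thesis
    using assms by unfold_locales (auto simp: symmetric_def sym_def)
qed

lemma pair_graph_direct_product:
  assumes "pair_graph G" "pair_graph H"
  shows "pair_graph (G \<times>\<^sub>d H)"
proof -
  interpret G: pair_graph G by fact
  interpret H: pair_graph H by fact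
  show ?thesis
  proof (rule pair_graphI)
    fix p q assume "(p, q) \<in> parcs (G \<times>\<^sub>d H)"
    then show "p \<in> pverts (G \<times>\<^sub>d H) \<and> q \<in> pverts (G \<times>\<^sub>d H) \<and> p \<noteq> q \<and> (q, p) \<in> parcs (G \<times>\<^sub>d H)"
      by (cases p; cases q)
        (auto dest: G.in_arcsD1 G.in_arcsD2 H.in_arcsD1 H.in_arcsD2 G.no_loops'
          intro: G.arcs_symmetric H.arcs_symmetric)
  qed (simp add: G.pair_finite_verts H.pair_finite_verts)
qed

lemma min_degree_direct_product_le:
  assumes "pair_graph G" "pair_graph H" "pverts G \<noteq> {}" "i \<in> pverts H"
  shows "min_degree (G \<times>\<^sub>d H) \<le> min_degree G * card (neighborhood H i)"
proof -
  obtain v where v: "v \<in> pverts G" "card (neighborhood G v) = min_degree G"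
    using pair_graph.min_degree_attained[OF assms(1,3)] .
  then show ?thesis
    using pair_graph.min_degree_le[OF pair_graph_direct_product[OF assms(1,2)], of "(v, i)"] assms(4)
    by (simp add: neighborhood_direct_product card_cartesian_product)
qed

lemma pair_graph_complete_graph: "pair_graph (complete_graph n)"
  by (rule pair_graphI) (auto simp: complete_graph_def)

text \<open>The bound excludes \<open>n = 1\<close>, where \<open>Suc 0 mod 1 = 0\<close> gives a
  loop.\<close>

lemma pair_graph_cycle_graph:
  assumes "n \<ge> 2"
  shows "pair_graph (cycle_graph n)"
  using assms by (intro pair_graphI) (auto simp: cycle_graph_def mod_Suc split: if_splits)

lemma cycle_graph_step:
  assumes "n > 0"
  shows "(i mod n, Suc i mod n) \<in> parcs (cycle_graph n)"
  using assms by (simp add: cycle_graph_def mod_Suc_eq)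

text \<open>Centering at \<open>Suc i\<close> lets the predecessor be written without
  subtraction.\<close>

lemma cycle_graph_neighbor_cases:
  assumes "(Suc i mod n, j) \<in> parcs (cycle_graph n)"
  shows "j = i mod n \<or> j = Suc (Suc i) mod n"
  using assms by (auto simp: cycle_graph_def mod_Suc_eq) (auto simp: mod_Suc split: if_splits)

lemma card_neighborhood_cycle_graph_le:
  assumes "n > 0"
  shows "card (neighborhood (cycle_graph n) 0) \<le> 2"
proof -
  have "neighborhood (cycle_graph n) 0 \<subseteq> {1 mod n, n - 1}"
    by (auto simp: neighborhood_def cycle_graph_def mod_Suc split: if_splits)
  then have "card (neighborhood (cycle_graph n) 0) \<le> card {1 mod n, n - 1}"
    by (intro card_mono) auto
  also have "\<dots> \<le> 2" by (simp add: card_insert_if)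
  finally show ?thesis .
qed

section \<open>Layers around the cycle\<close>

text \<open>Positions \<open>t \<le> n\<close> go once around the cycle, \<open>f t\<close> is the number of deleted vertices in
  layer \<open>t\<close>, and \<open>P t\<close> says that the rest of layer \<open>t\<close> lies in the component of the starting layer.
  A gap in \<open>P\<close> has to be bounded on both sides by layers with at least \<open>d\<close> deletions, which uses
  up all \<open>2 * d\<close> of them.\<close>

lemma spread_around_cycle:
  fixes f :: "nat \<Rightarrow> nat"
  assumes start: "P 0" "P n" "f 0 < d" "f n < d"
    and up: "\<And>t. P t \<Longrightarrow> f t < d \<Longrightarrow> P (Suc t)"
    and down: "\<And>t. P (Suc t) \<Longrightarrow> f (Suc t) < d \<Longrightarrow> P t"
    and single: "\<And>t. P t \<Longrightarrow> P (Suc (Suc t)) \<Longrightarrow> P (Suc t)"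
    and pair: "\<And>t. P t \<Longrightarrow> f t \<le> d \<Longrightarrow> f (Suc t) = 0 \<Longrightarrow> f (Suc (Suc t)) = 0 \<Longrightarrow> P (Suc t)"
    and total: "sum f {..<n} \<le> 2 * d"
    and "t \<le> n"
  shows "P t"
proof (rule ccontr)
  assume "\<not> P t"
  \<comment> \<open>\<open>a\<close> and \<open>b\<close> are the nearest positions on either side
    of \<open>t\<close> where \<open>P\<close> holds; they bound the gap containing
    \<open>t\<close>.\<close>
  define a where "a = (GREATEST s. s < t \<and> P s)"
  define b where "b = (LEAST s. s > t \<and> P s)"
  have "t \<noteq> 0" "t \<noteq> n" using \<open>\<not> P t\<close> start by metis+
  then have t: "0 < t" "t < n" using \<open>t \<le> n\<close> by auto
  have a: "a < t \<and> P a"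
    unfolding a_def by (rule GreatestI_nat[of "\<lambda>s. s < t \<and> P s" 0 t]) (use t start in auto)
  have a_max: "s \<le> a" if "s < t" "P s" for s
    unfolding a_def by (rule Greatest_le_nat[of "\<lambda>s. s < t \<and> P s" s t]) (use that in auto)
  have b: "b > t \<and> P b"
    unfolding b_def by (rule LeastI[of "\<lambda>s. s > t \<and> P s" n]) (use t start in auto)
  have b_min: "b \<le> s" if "s > t" "P s" for s
    unfolding b_def by (rule Least_le) (use that in auto)
  have gap: "\<not> P s" if "a < s" "s < b" for s
    using that a_max[of s] b_min[of s] \<open>\<not> P t\<close> by (cases s t rule: linorder_cases) auto
  have "f a \<ge> d"
    using up[of a] gap[of "Suc a"] a b by (meson lessI less_trans_Suc not_le)
  have "f b \<ge> d"
    using down[of "b - 1"] gap[of "b - 1"] a b by (cases b) (auto intro: leI)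
  \<comment> \<open>Position \<open>n\<close> has fewer than \<open>d\<close> deletions, so it
    cannot be \<open>b\<close>. Thus \<open>a\<close> and \<open>b\<close> are distinct terms of the
    sum and exhaust it.\<close>
  have "b < n"
    using b_min[OF t(2)] start \<open>f b \<ge> d\<close> by (cases "b = n") auto
  have split: "sum f {..<n} = f a + f b + sum f ({..<n} - {a, b})"
    using a b \<open>b < n\<close> by (subst sum.subset_diff[of "{a, b}"]) auto
  have "f a \<le> d" and rest: "sum f ({..<n} - {a, b}) = 0"
    using split total \<open>f a \<ge> d\<close> \<open>f b \<ge> d\<close> by linarith+
  have zero: "f s = 0" if "s < n" "s \<noteq> a" "s \<noteq> b" for s
    using rest that by simp
  show False
  proof (cases "b = Suc (Suc a)")
    case True
    then show False using single[of a] a b gap[of "Suc a"] by simp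
  next
    case False
    then have "Suc (Suc a) < b" using a b by linarith
    then show False
      using pair[of a] a \<open>f a \<le> d\<close> zero \<open>b < n\<close> gap[of "Suc a"] by simp
  qed
qed

lemma sum_rotate_mod:
  fixes f :: "nat \<Rightarrow> nat"
  assumes "n > 0"
  shows "(\<Sum>t<n. f ((i + t) mod n)) = sum f {..<n}"
proof (induction i)
  case 0
  show ?case by simp
next
  case (Suc i)
  let ?g = "\<lambda>t. f ((i + t) mod n)"
  \<comment> \<open>Of these \<open>n + 1\<close> terms the first and the last agree modulo
    \<open>n\<close>, so dropping either one leaves the same sum.\<close>
  have "(\<Sum>t<Suc n. ?g t) = ?g 0 + (\<Sum>t<n. ?g (Suc t))"
    by (rule sum.lessThan_Suc_shift)
  then have "(\<Sum>t<n. ?g (Suc t)) = (\<Sum>t<n. ?g t)" by simp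
  then show ?case using Suc by simp
qed

text \<open>The map \<open>h\<close> sends the two layers of the product with
  \<open>complete_graph 2\<close> to layers \<open>a\<close> and \<open>b\<close> and preserves
  arcs. The preimage \<open>T\<close> of \<open>S\<close> is too small to disconnect that product,
  so walks avoiding \<open>T\<close> can be carried over to walks avoiding \<open>S\<close>.\<close>

lemma adjacent_layers_connected:
  assumes G: "pair_graph G" and V: "pverts G \<noteq> {}"
    and ab: "(a, b) \<in> parcs H" "(b, a) \<in> parcs H" "a \<in> pverts H" "b \<in> pverts H"
    and card: "card {u \<in> pverts G. (u, a) \<in> S} + card {u \<in> pverts G. (u, b) \<in> S}
      < connectivity (G \<times>\<^sub>d complete_graph 2)"
    and x: "x \<in> pverts G \<times> {a, b} - S" and y: "y \<in> pverts G \<times> {a, b} - S"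
  shows "(x, y) \<in> rtrancl_on (pverts (G \<times>\<^sub>d H) - S) (parcs (G \<times>\<^sub>d H))"
proof -
  let ?K = "G \<times>\<^sub>d complete_graph 2"
  interpret K: pair_graph ?K
    by (rule pair_graph_direct_product[OF G pair_graph_complete_graph])
  define h where "h = (\<lambda>(u, i::nat). (u :: 'a, if i = 0 then a else b))"
  define T where "T = {p \<in> pverts ?K. h p \<in> S}"
  have T: "T = {u \<in> pverts G. (u, a) \<in> S} \<times> {0} \<union> {u \<in> pverts G. (u, b) \<in> S} \<times> {1}"
    by (auto simp: T_def h_def complete_graph_def split: if_splits)
  have "card T \<le> card {u \<in> pverts G. (u, a) \<in> S} + card {u \<in> pverts G. (u, b) \<in> S}"
    unfolding T by (rule order_trans[OF card_Un_le]) (simp add: card_cartesian_product)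
  then have "Digraph_Component.connected (with_proj ?K \<restriction> (pverts ?K - T))"
    using card V by (intro K.connected_if_card_less_connectivity) (auto simp: T_def complete_graph_def lessThan_empty_iff)
  then have conn: "(p, q) \<in> rtrancl_on (pverts ?K - T) (parcs ?K)"
    if "p \<in> pverts ?K - T" "q \<in> pverts ?K - T" for p q
    using that by (auto simp: K.connected_induce_iff)
  have lift: "\<exists>p \<in> pverts ?K - T. h p = z" if z_in: "z \<in> pverts G \<times> {a, b} - S" for z
  proof -
    obtain u c where z: "z = (u, c)" "u \<in> pverts G" "c = a \<or> c = b"
      using z_in by auto
    define p where "p = (u, if c = a then 0 else 1 :: nat)"
    have "h p = z" using z by (auto simp: p_def h_def)
    moreover have "p \<in> pverts ?K" using z by (simp add: p_def complete_graph_def)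
    ultimately show ?thesis using z_in by (auto simp: T_def)
  qed
  obtain p q where p: "p \<in> pverts ?K - T" "h p = x" and q: "q \<in> pverts ?K - T" "h q = y"
    using lift[OF x] lift[OF y] by blast
  have "(h p, h q) \<in> rtrancl_on (pverts (G \<times>\<^sub>d H) - S) (parcs (G \<times>\<^sub>d H))"
  proof (rule rtrancl_on_map[OF conn[OF p(1) q(1)]])
    show "h r \<in> pverts (G \<times>\<^sub>d H) - S" if "r \<in> pverts ?K - T" for r
      using that ab by (auto simp: T_def h_def)
    show "(h r, h s) \<in> parcs (G \<times>\<^sub>d H)" if "(r, s) \<in> parcs ?K" for r s
      using that ab by (cases r; cases s) (auto simp: h_def complete_graph_def)
  qed
  then show ?thesis using p q by simp
qed

section \<open>Minimum cuts of the product with a cycle\<close>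

theorem theorem3p7:
  fixes G :: "'a pair_pre_digraph" and n :: nat
  assumes "pair_graph G"
    and "Digraph_Component.connected (with_proj G)"
    and "\<not> bipartite G"
    and "n \<ge> 6" and "even n"
    and "real (connectivity (G \<times>\<^sub>d complete_graph 2)) > 4 / real n * real (min_degree G)"
  shows "super_connected (G \<times>\<^sub>d cycle_graph n)"
proof -
  interpret G: pair_graph G by fact
  let ?C = "cycle_graph n" and ?K = "G \<times>\<^sub>d complete_graph 2"
  let ?H = "G \<times>\<^sub>d ?C"
  have n: "n > 0" using \<open>n \<ge> 6\<close> by simp
  have C: "pair_graph ?C" using \<open>n \<ge> 6\<close> by (intro pair_graph_cycle_graph) simp
  interpret H: pair_graph ?H by (rule pair_graph_direct_product[OF assms(1) C])
  interpret K: pair_graph ?K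
    by (rule pair_graph_direct_product[OF assms(1) pair_graph_complete_graph])
  have V: "pverts G \<noteq> {}"
    using assms(2) by (auto simp: connected_def strongly_connected_def)
  have verts_C: "pverts ?C = {..<n}" by (simp add: cycle_graph_def)
  define \<delta> where "\<delta> = min_degree G"
  define \<kappa> where "\<kappa> = connectivity ?K"
  have \<kappa>: "4 * \<delta> < n * \<kappa>"
  proof -
    have "4 * real \<delta> < real n * real \<kappa>"
      using assms(6) n by (simp add: \<delta>_def \<kappa>_def field_simps)
    then show ?thesis by (metis of_nat_less_iff of_nat_mult of_nat_numeral)
  qed
  then have "\<kappa> > 0" by (cases \<kappa>) auto
  \<comment> \<open>Aim: \<open>\<kappa> \<le> \<delta>\<close>, so that two layers with fewer than
    \<open>\<kappa>\<close> deletions together have fewer than \<open>\<delta>\<close> each.\<close>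
  have "\<kappa> \<le> min_degree ?K"
    unfolding \<kappa>_def using V by (intro K.connectivity_le_min_degree) (auto simp: complete_graph_def lessThan_empty_iff)
  also have "\<dots> \<le> \<delta> * card (neighborhood (complete_graph 2) 0)"
    unfolding \<delta>_def using V
    by (intro min_degree_direct_product_le pair_graph_complete_graph assms) (auto simp: complete_graph_def)
  also have "neighborhood (complete_graph 2) 0 = {1}"
    by (auto simp: neighborhood_def complete_graph_def)
  finally have "\<kappa> \<le> \<delta>" by simp
  have \<delta>_less: "\<delta> < card (pverts G)" unfolding \<delta>_def using V by (rule G.min_degree_less_order)
  have "min_degree ?H \<le> \<delta> * card (neighborhood ?C 0)"
    unfolding \<delta>_def using V n by (intro min_degree_direct_product_le assms C) (auto simp: verts_C)
  also have "\<dots> \<le> 2 * \<delta>" using card_neighborhood_cycle_graph_le[OF n] by simp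
  finally have min_degree_H: "min_degree ?H \<le> 2 * \<delta>" .
  have H_nonempty: "pverts ?H \<noteq> {}" using V n by (auto simp: verts_C)
  show ?thesis
    unfolding super_connected_def
  proof (intro allI impI)
    fix S assume S: "minimum_vertex_cut ?H S"
    define W where "W = pverts ?H - S"
    have S_sub: "S \<subseteq> pverts G \<times> {..<n}" and "W \<noteq> {}"
      and not_connected: "\<not> Digraph_Component.connected (with_proj ?H \<restriction> W)"
      using S by (auto simp: minimum_vertex_cut_def vertex_cut_def verts_C W_def)
    have card_S: "card S \<le> min_degree ?H"
      using S H.connectivity_le_min_degree[OF H_nonempty] by (simp add: minimum_vertex_cut_def)
    have finite_S: "finite S"
      using S_sub G.pair_finite_verts by (meson finite_SigmaI finite_lessThan finite_subset)
    \<comment> \<open>If no survivor is isolated, all of \<open>W\<close> turns out to be connected,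
      against the choice of \<open>S\<close>.\<close>
    have "\<exists>v \<in> W. neighborhood ?H v \<subseteq> S"
    proof (rule ccontr)
      assume "\<not> ?thesis"
      then have neighbor: "\<exists>w \<in> W. (v, w) \<in> parcs ?H" if "v \<in> W" for v
        using that H.in_arcsD2 by (fastforce simp: neighborhood_def W_def)
      define c where "c i = card {u \<in> pverts G. (u, i) \<in> S}" for i
      have sum_c: "sum c {..<n} = card S"
      proof -
        have "S = (\<Union>i\<in>{..<n}. {u \<in> pverts G. (u, i) \<in> S} \<times> {i})" using S_sub by auto
        then have "card S = card (\<Union>i\<in>{..<n}. {u \<in> pverts G. (u, i) \<in> S} \<times> {i})" by simp
        also have "\<dots> = (\<Sum>i<n. card ({u \<in> pverts G. (u, i) \<in> S} \<times> {i}))"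
          by (intro card_UN_disjoint) (auto simp: G.pair_finite_verts)
        finally show ?thesis by (simp add: c_def card_cartesian_product)
      qed
      \<comment> \<open>Each layer lies in two of the \<open>n\<close> consecutive pairs, so the
        pair sums total \<open>2 * card S\<close>, at most \<open>4 * \<delta>\<close> and hence
        below \<open>n * \<kappa>\<close>.\<close>
      have "\<exists>i<n. c i + c ((1 + i) mod n) < \<kappa>"
      proof (rule ccontr)
        assume "\<not> ?thesis"
        then have "(\<Sum>i<n. \<kappa>) \<le> (\<Sum>i<n. c i + c ((1 + i) mod n))"
          by (intro sum_mono) (meson lessThan_iff not_less)
        also have "\<dots> = 2 * card S"
          using sum_rotate_mod[OF n, of c 1] by (simp add: sum.distrib sum_c)
        finally show False using \<kappa> card_S min_degree_H by simp
      qed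
      then obtain i0 where i0: "i0 < n" "c i0 + c ((1 + i0) mod n) < \<kappa>" by blast
      \<comment> \<open>Renumbering puts the sparse pair at positions 0 and 1; position
        \<open>n\<close> is layer \<open>i0\<close> again.\<close>
      define lay where "lay t = (i0 + t) mod n" for t
      have lay_less: "lay t < n" for t using n by (simp add: lay_def)
      have step: "(lay t, lay (Suc t)) \<in> parcs ?C" "(lay (Suc t), lay t) \<in> parcs ?C" for t
        using cycle_graph_step[OF n, of "i0 + t"]
        by (auto simp: lay_def cycle_graph_def)
      let ?R = "rtrancl_on W (parcs ?H)"
      have reach: "(x, y) \<in> ?R"
        if "c (lay t) + c (lay (Suc t)) < \<kappa>"
          "x \<in> pverts G \<times> {lay t, lay (Suc t)} - S" "y \<in> pverts G \<times> {lay t, lay (Suc t)} - S"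
        for t x y
        using that step lay_less V unfolding W_def c_def \<kappa>_def
        by (intro adjacent_layers_connected[where a = "lay t" and b = "lay (Suc t)"] assms)
          (auto simp: verts_C)
      have survivor: "\<exists>u \<in> pverts G. (u, i) \<notin> S" if "c i \<le> \<delta>" for i
      proof (rule ccontr)
        assume "\<not> ?thesis"
        then have "{u \<in> pverts G. (u, i) \<in> S} = pverts G" by auto
        then show False using that \<delta>_less by (simp add: c_def)
      qed
      have good0: "c (lay 0) + c (lay (Suc 0)) < \<kappa>"
        using i0 by (simp add: lay_def)
      then obtain u0 where u0: "u0 \<in> pverts G" "(u0, lay 0) \<notin> S"
        using survivor[of "lay 0"] \<open>\<kappa> \<le> \<delta>\<close> by auto
      define z where "z = (u0, lay 0)"
      \<comment> \<open>This holds vacuously for a layer that is deleted entirely.\<close>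
      define P where "P t \<longleftrightarrow> (\<forall>u \<in> pverts G. (u, lay t) \<notin> S \<longrightarrow> (z, u, lay t) \<in> ?R)" for t
      have extend: "(z, u, j) \<in> ?R"
        if "(z, u', i) \<in> ?R" "(u', u) \<in> parcs G" "(i, j) \<in> parcs ?C" "(u, j) \<notin> S" for u u' i j
      proof -
        have "(u, j) \<in> W" using that by (auto simp: W_def cycle_graph_def dest: G.in_arcsD2)
        then show ?thesis using that by (auto intro: rtrancl_on_into_rtrancl_on)
      qed
      have spread: "P t" if "P s" "c (lay s) < \<delta>" "(lay s, lay t) \<in> parcs ?C" for s t
        unfolding P_def
      proof (intro ballI impI)
        fix u assume u: "u \<in> pverts G" "(u, lay t) \<notin> S"
        \<comment> \<open>\<open>u\<close> has at least \<open>\<delta>\<close> neighbors in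
          \<open>G\<close>, more than layer \<open>lay s\<close> has deleted vertices.\<close>
        have "\<not> neighborhood G u \<subseteq> {u \<in> pverts G. (u, lay s) \<in> S}"
        proof
          assume "neighborhood G u \<subseteq> {u \<in> pverts G. (u, lay s) \<in> S}"
          then have "card (neighborhood G u) \<le> c (lay s)"
            unfolding c_def by (intro card_mono) (auto simp: G.pair_finite_verts)
          then show False using G.min_degree_le[OF u(1)] that by (simp add: \<delta>_def)
        qed
        then obtain u' where "(u, u') \<in> parcs G" "(u', lay s) \<notin> S" "u' \<in> pverts G"
          by (auto simp: neighborhood_def dest: G.in_arcsD2)
        then show "(z, u, lay t) \<in> ?R"
          using that u extend[of u' "lay s" u "lay t"] G.arcs_symmetric by (auto simp: P_def)
      qed
      have "P t" if "t \<le> n" for t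
      proof (rule spread_around_cycle[where f = "\<lambda>t. c (lay t)" and d = \<delta> and n = n and P = P])
        show "P 0"
          unfolding P_def z_def using u0 good0 by (auto intro!: reach)
        then show "P n" by (simp add: P_def lay_def)
        show "c (lay 0) < \<delta>" using good0 \<open>\<kappa> \<le> \<delta>\<close> by simp
        then show "c (lay n) < \<delta>" by (simp add: lay_def)
        show "P (Suc t)" if "P t" "c (lay t) < \<delta>" for t
          using spread that step by blast
        show "P t" if "P (Suc t)" "c (lay (Suc t)) < \<delta>" for t
          using spread that step by blast
        \<comment> \<open>A survivor has a surviving neighbor, which lies in one of the two adjacent
          layers, both already reached.\<close>
        show "P (Suc t)" if "P t" "P (Suc (Suc t))" for t
          unfolding P_def
        proof (intro ballI impI)
          fix u assume u: "u \<in> pverts G" "(u, lay (Suc t)) \<notin> S"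
          then have "(u, lay (Suc t)) \<in> W" using lay_less by (simp add: W_def verts_C)
          then obtain u' j where w: "(u', j) \<in> W" "(u, u') \<in> parcs G" "(lay (Suc t), j) \<in> parcs ?C"
            using neighbor by fastforce
          then have "j = lay t \<or> j = lay (Suc (Suc t))"
            using cycle_graph_neighbor_cases[of "i0 + t" n j] by (simp add: lay_def)
          then have "(z, u', j) \<in> ?R" "(j, lay (Suc t)) \<in> parcs ?C"
            using that w step by (auto simp: P_def W_def)
          then show "(z, u, lay (Suc t)) \<in> ?R"
            using extend w u G.arcs_symmetric by blast
        qed
        \<comment> \<open>A survivor \<open>u\<close> of layer \<open>lay t\<close> leads into the
          next layer. That layer and the following one have no deletions, and
          \<open>0 < \<kappa>\<close> makes this pair connected.\<close>
        show "P (Suc t)"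
          if "P t" "c (lay t) \<le> \<delta>" "c (lay (Suc t)) = 0" "c (lay (Suc (Suc t))) = 0" for t
        proof -
          obtain u where u: "u \<in> pverts G" "(u, lay t) \<notin> S" using survivor \<open>c (lay t) \<le> \<delta>\<close> by blast
          have "neighborhood G u \<noteq> {}"
            using G.min_degree_le[OF u(1)] \<open>\<kappa> > 0\<close> \<open>\<kappa> \<le> \<delta>\<close> by (auto simp: \<delta>_def)
          then obtain u' where u': "(u, u') \<in> parcs G" by (auto simp: neighborhood_def)
          then have "u' \<in> pverts G" by (rule G.in_arcsD2)
          then have "(u', lay (Suc t)) \<notin> S"
            using \<open>c (lay (Suc t)) = 0\<close> G.pair_finite_verts by (auto simp: c_def)
          then have "(z, u', lay (Suc t)) \<in> ?R"
            using \<open>P t\<close> u u' step extend by (auto simp: P_def)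
          moreover have "((u', lay (Suc t)), (v, lay (Suc t))) \<in> ?R"
            if "v \<in> pverts G" "(v, lay (Suc t)) \<notin> S" for v
            using reach[of "Suc t"] that \<open>(u', lay (Suc t)) \<notin> S\<close> \<open>u' \<in> pverts G\<close> \<open>\<kappa> > 0\<close>
              \<open>c (lay (Suc t)) = 0\<close> \<open>c (lay (Suc (Suc t))) = 0\<close> by auto
          ultimately show ?thesis
            unfolding P_def by (blast intro: rtrancl_on_trans)
        qed
        show "(\<Sum>t<n. c (lay t)) \<le> 2 * \<delta>"
          using sum_rotate_mod[OF n, of c i0] card_S min_degree_H by (simp add: sum_c lay_def)
      qed fact
      moreover have "\<exists>t \<le> n. i = lay t" if "i < n" for i
      proof (intro exI conjI)
        \<comment> \<open>Adding \<open>n\<close> first keeps the natural-number subtraction from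
          truncating.\<close>
        show "(i + n - i0) mod n \<le> n" using n by (simp add: less_imp_le)
        show "i = lay ((i + n - i0) mod n)"
          using that i0 by (simp add: lay_def mod_add_right_eq)
      qed
      ultimately have "(z, u, i) \<in> ?R" if "u \<in> pverts G" "i < n" "(u, i) \<notin> S" for u i
        using that unfolding P_def by blast
      then have "(z, w) \<in> ?R" if "w \<in> W" for w
        using that by (cases w) (simp add: W_def verts_C)
      then have "(v, w) \<in> ?R" if "v \<in> W" "w \<in> W" for v w
        using that H.rtrancl_on_arcs_sym rtrancl_on_trans by metis
      then show False
        using not_connected \<open>W \<noteq> {}\<close> by (auto simp: H.connected_induce_iff)
    qed
    then obtain v where v: "v \<in> pverts ?H" "neighborhood ?H v \<subseteq> S" by (auto simp: W_def)
    \<comment> \<open>The degree of \<open>v\<close> is at most \<open>card S\<close>, which is at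
      most the minimum degree, so all three agree and the inclusion is an equality.\<close>
    have "card (neighborhood ?H v) \<le> card S" using v finite_S card_mono by blast
    then have "card (neighborhood ?H v) = card S" "card (neighborhood ?H v) = min_degree ?H"
      using card_S H.min_degree_le[OF v(1)] by auto
    then show "\<exists>v \<in> pverts ?H. out_degree (with_proj ?H) v = min_degree ?H \<and> S = neighborhood ?H v"
      using v finite_S card_subset_eq by (metis out_degree_eq_card_neighborhood)
  qed
qed

end
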